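(* Let $(M,\varphi_\alpha,\xi_\alpha,\eta_\alpha,g)$, $\alpha=1,2,3$, be a manifold with almost contact 3-structure and metrics of Hermitian-Norden type. If two of the associated Nijenhuis tensors $\widehat N_1$, $\widehat N_2$, $\widehat N_3$ vanish, then the third also vanishes.
   Context: A manifold with almost contact 3-structure is a $(4n+3)$-dimensional manifold $M$ with three almost contact structures $(\varphi_\alpha,\xi_\alpha,\eta_\alpha)$, $\alpha=1,2,3$, satisfying $\varphi_\alpha\circ\varphi_\beta=-\delta_{\alpha\beta}I+\xi_\alpha\otimes\eta_\beta+\epsilon_{\alpha\beta\gamma}\varphi_\gamma$, $\varphi_\alpha\xi_\beta=\epsilon_{\alpha\beta\gamma}\xi_\gamma$, $\eta_\alpha\circ\varphi_\beta=\epsilon_{\alpha\beta\gamma}\eta_\gamma$, $\eta_\alpha(\xi_\beta)=\delta_{\alpha\beta}$, where $(\xi_\alpha\otimes\eta_\beta)(x)=\eta_\beta(x)\xi_\alpha$, $\delta$ is the Kronecker delta and $\epsilon_{\alpha\beta\gamma}$ the Levi-Civita symbol. A pseudo-Riemannian metric $g$ is of Hermitian-Norden type if $g(\varphi_\alpha x,\varphi_\alpha y)=\varepsilon_\alpha g(x,y)+\eta_\alpha(x)\eta_\alpha(y)$ with $(\varepsilon_1,\varepsilon_2,\varepsilon_3)=(1,-1,-1)$. With $\nabla$ the Levi-Civita connection of $g$, put $\{x,y\}=\nabla_xy+\nabla_yx$ and $\{\varphi_\alpha,\varphi_\alpha\}(x,y)=\{\varphi_\alpha x,\varphi_\alpha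 y\}+\varphi_\alpha^2\{x,y\}-\varphi_\alpha\{\varphi_\alpha x,y\}-\varphi_\alpha\{x,\varphi_\alpha y\}$. The associated Nijenhuis tensors are the symmetric $(1,2)$-tensors $\widehat N_\alpha=\{\varphi_\alpha,\varphi_\alpha\}-\varepsilon_\alpha\,\xi_\alpha\otimes\mathcal L_{\xi_\alpha}g$, where $\mathcal L_{\xi_\alpha}g$ is the Lie derivative of $g$ along $\xi_\alpha$. *)

theory Defs
  imports "HOL-Analysis.Analysis" "HOL-Library.Function_Algebras"
begin

section \<open>Smooth manifolds\<close>

text \<open>
  For open \<open>S\<close>: \<open>f\<close> has continuous iterated directional derivatives up to order \<open>k\<close> on \<open>S\<close>,
  that is, \<open>f\<close> is of class \<open>C\<^sup>k\<close>.
\<close>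

fun diff_of_order_on ::
  "nat \<Rightarrow> 'e::euclidean_space set \<Rightarrow> ('e \<Rightarrow> 'f::euclidean_space) \<Rightarrow> bool" where
  "diff_of_order_on 0 S f \<longleftrightarrow> continuous_on S f"
| "diff_of_order_on (Suc k) S f \<longleftrightarrow>
     (\<forall>x\<in>S. f differentiable (at x)) \<and>
     (\<forall>v. diff_of_order_on k S (\<lambda>x. frechet_derivative f (at x) v))"

definition smooth_on :: "'e::euclidean_space set \<Rightarrow> ('e \<Rightarrow> 'f::euclidean_space) \<Rightarrow> bool" where
  "smooth_on S f \<longleftrightarrow> (\<forall>k. diff_of_order_on k S f)"

text \<open>
  A manifold is a whole type \<open>'a\<close> (Hausdorff and second countable) with a set of charts
  \<open>(U, c)\<close>, where \<open>c\<close> maps the open set \<open>U\<close> homeomorphically onto an open subset of \<open>'e\<close>.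
  The values of \<open>c\<close> outside \<open>U\<close> are irrelevant. The dimension of the manifold is \<open>DIM('e)\<close>.
  The atlas is not required to be maximal.
\<close>

type_synonym ('a, 'e) atlas = "('a set \<times> ('a \<Rightarrow> 'e)) set"

definition smooth_manifold ::
  "('a::{t2_space, second_countable_topology}, 'e::euclidean_space) atlas \<Rightarrow> bool" where
  "smooth_manifold A \<longleftrightarrow>
     (\<Union>(U, c)\<in>A. U) = UNIV \<and>
     (\<forall>(U, c)\<in>A. open U \<and> open (c ` U) \<and> (\<exists>c'. homeomorphism U (c ` U) c c')) \<and>
     (\<forall>(U, c)\<in>A. \<forall>(V, d)\<in>A. smooth_on (c ` (U \<inter> V)) (d \<circ> inv_into U c))"

definition smooth_functions :: "('a, 'e::euclidean_space) atlas \<Rightarrow> ('a \<Rightarrow> real) set" where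
  "smooth_functions A = {f. \<forall>(U, c)\<in>A. smooth_on (c ` U) (f \<circ> inv_into U c)}"

section \<open>Tangent vectors, vector fields and tensor fields\<close>

text \<open>
  Tangent vectors at \<open>p\<close> are the point derivations of the algebra of smooth functions. They are
  set to \<open>0\<close> on functions that are not smooth, so that equality of tangent vectors is equality
  in HOL. Sums and differences of tangent vectors and of vector fields are the pointwise ones.
\<close>

type_synonym 'a tangent = "('a \<Rightarrow> real) \<Rightarrow> real"
type_synonym 'a vfield = "'a \<Rightarrow> 'a tangent"

definition tscale :: "real \<Rightarrow> 'a tangent \<Rightarrow> 'a tangent" (infixr "*\<^sub>T" 75) where
  "r *\<^sub>T v = (\<lambda>f. r * v f)"

definition fscale :: "('a \<Rightarrow> real) \<Rightarrow> 'a vfield \<Rightarrow> 'a vfield" (infixr "*\<^sub>F" 75) where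
  "h *\<^sub>F X = (\<lambda>p. h p *\<^sub>T X p)"

definition tangent_space :: "('a, 'e::euclidean_space) atlas \<Rightarrow> 'a \<Rightarrow> 'a tangent set" where
  "tangent_space A p =
     {v. (\<forall>f\<in>smooth_functions A. \<forall>h\<in>smooth_functions A. v (\<lambda>q. f q + h q) = v f + v h) \<and>
         (\<forall>f\<in>smooth_functions A. \<forall>r. v (\<lambda>q. r * f q) = r * v f) \<and>
         (\<forall>f\<in>smooth_functions A. \<forall>h\<in>smooth_functions A.
            v (\<lambda>q. f q * h q) = f p * v h + h p * v f) \<and>
         (\<forall>f. f \<notin> smooth_functions A \<longrightarrow> v f = 0)}"

definition deriv_along :: "'a vfield \<Rightarrow> ('a \<Rightarrow> real) \<Rightarrow> ('a \<Rightarrow> real)" where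
  "deriv_along X f = (\<lambda>p. X p f)"

definition vector_fields :: "('a, 'e::euclidean_space) atlas \<Rightarrow> 'a vfield set" where
  "vector_fields A =
     {X. (\<forall>p. X p \<in> tangent_space A p) \<and>
         (\<forall>f\<in>smooth_functions A. deriv_along X f \<in> smooth_functions A)}"

definition lie_bracket :: "'a vfield \<Rightarrow> 'a vfield \<Rightarrow> 'a vfield" where
  "lie_bracket X Y = (\<lambda>p f. X p (deriv_along Y f) - Y p (deriv_along X f))"

text \<open>
  Tensor fields are pointwise (multi)linear on the tangent spaces; such a field is smooth iff
  its values on smooth vector fields are smooth.
\<close>

definition one_form ::
  "('a, 'e::euclidean_space) atlas \<Rightarrow> ('a \<Rightarrow> 'a tangent \<Rightarrow> real) \<Rightarrow> bool" where
  "one_form A \<eta> \<longleftrightarrow>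
     (\<forall>p. \<forall>u\<in>tangent_space A p. \<forall>v\<in>tangent_space A p. \<eta> p (u + v) = \<eta> p u + \<eta> p v) \<and>
     (\<forall>p. \<forall>u\<in>tangent_space A p. \<forall>r. \<eta> p (r *\<^sub>T u) = r * \<eta> p u) \<and>
     (\<forall>X\<in>vector_fields A. (\<lambda>p. \<eta> p (X p)) \<in> smooth_functions A)"

definition endomorphism_field ::
  "('a, 'e::euclidean_space) atlas \<Rightarrow> ('a \<Rightarrow> 'a tangent \<Rightarrow> 'a tangent) \<Rightarrow> bool" where
  "endomorphism_field A \<phi> \<longleftrightarrow>
     (\<forall>p. \<forall>u\<in>tangent_space A p. \<phi> p u \<in> tangent_space A p) \<and>
     (\<forall>p. \<forall>u\<in>tangent_space A p. \<forall>v\<in>tangent_space A p. \<phi> p (u + v) = \<phi> p u + \<phi> p v) \<and>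
     (\<forall>p. \<forall>u\<in>tangent_space A p. \<forall>r. \<phi> p (r *\<^sub>T u) = r *\<^sub>T \<phi> p u) \<and>
     (\<forall>X\<in>vector_fields A. (\<lambda>p. \<phi> p (X p)) \<in> vector_fields A)"

definition apply_field :: "('a \<Rightarrow> 'a tangent \<Rightarrow> 'a tangent) \<Rightarrow> 'a vfield \<Rightarrow> 'a vfield" where
  "apply_field \<phi> X = (\<lambda>p. \<phi> p (X p))"

definition pseudo_riemannian_metric ::
  "('a, 'e::euclidean_space) atlas \<Rightarrow> ('a \<Rightarrow> 'a tangent \<Rightarrow> 'a tangent \<Rightarrow> real) \<Rightarrow> bool" where
  "pseudo_riemannian_metric A g \<longleftrightarrow>
     (\<forall>p. \<forall>u\<in>tangent_space A p. \<forall>v\<in>tangent_space A p. \<forall>w\<in>tangent_space A p.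
        g p (u + v) w = g p u w + g p v w) \<and>
     (\<forall>p. \<forall>u\<in>tangent_space A p. \<forall>w\<in>tangent_space A p. \<forall>r. g p (r *\<^sub>T u) w = r * g p u w) \<and>
     (\<forall>p. \<forall>u\<in>tangent_space A p. \<forall>v\<in>tangent_space A p. g p u v = g p v u) \<and>
     (\<forall>p. \<forall>u\<in>tangent_space A p. (\<forall>v\<in>tangent_space A p. g p u v = 0) \<longrightarrow> u = 0) \<and>
     (\<forall>X\<in>vector_fields A. \<forall>Y\<in>vector_fields A. (\<lambda>p. g p (X p) (Y p)) \<in> smooth_functions A)"

section \<open>Levi-Civita connection and Lie derivative\<close>

definition affine_connection ::
  "('a, 'e::euclidean_space) atlas \<Rightarrow> ('a vfield \<Rightarrow> 'a vfield \<Rightarrow> 'a vfield) \<Rightarrow> bool" where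
  "affine_connection A nabla \<longleftrightarrow>
     (\<forall>X\<in>vector_fields A. \<forall>Y\<in>vector_fields A. nabla X Y \<in> vector_fields A) \<and>
     (\<forall>X\<in>vector_fields A. \<forall>X'\<in>vector_fields A. \<forall>Y\<in>vector_fields A.
        nabla (X + X') Y = nabla X Y + nabla X' Y) \<and>
     (\<forall>h\<in>smooth_functions A. \<forall>X\<in>vector_fields A. \<forall>Y\<in>vector_fields A.
        nabla (h *\<^sub>F X) Y = h *\<^sub>F nabla X Y) \<and>
     (\<forall>X\<in>vector_fields A. \<forall>Y\<in>vector_fields A. \<forall>Y'\<in>vector_fields A.
        nabla X (Y + Y') = nabla X Y + nabla X Y') \<and>
     (\<forall>h\<in>smooth_functions A. \<forall>X\<in>vector_fields A. \<forall>Y\<in>vector_fields A.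
        nabla X (h *\<^sub>F Y) = deriv_along X h *\<^sub>F Y + h *\<^sub>F nabla X Y)"

definition levi_civita_connection ::
  "('a, 'e::euclidean_space) atlas \<Rightarrow> ('a \<Rightarrow> 'a tangent \<Rightarrow> 'a tangent \<Rightarrow> real)
     \<Rightarrow> ('a vfield \<Rightarrow> 'a vfield \<Rightarrow> 'a vfield) \<Rightarrow> bool" where
  "levi_civita_connection A g nabla \<longleftrightarrow>
     affine_connection A nabla \<and>
     (\<forall>X\<in>vector_fields A. \<forall>Y\<in>vector_fields A. nabla X Y - nabla Y X = lie_bracket X Y) \<and>
     (\<forall>X\<in>vector_fields A. \<forall>Y\<in>vector_fields A. \<forall>Z\<in>vector_fields A. \<forall>p.
        X p (\<lambda>q. g q (Y q) (Z q)) = g p (nabla X Y p) (Z p) + g p (Y p) (nabla X Z p))"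

text \<open>
  The Lie derivative of \<open>g\<close> along \<open>Z\<close>, as a function of \<open>X\<close> and \<open>Y\<close>:
  \<open>(\<L>\<^sub>Z g)(X, Y) = Z (g (X, Y)) - g ([Z, X], Y) - g (X, [Z, Y])\<close>.
\<close>

definition lie_derivative ::
  "'a vfield \<Rightarrow> ('a \<Rightarrow> 'a tangent \<Rightarrow> 'a tangent \<Rightarrow> real) \<Rightarrow> 'a vfield \<Rightarrow> 'a vfield \<Rightarrow> 'a \<Rightarrow> real" where
  "lie_derivative Z g X Y =
     (\<lambda>p. Z p (\<lambda>q. g q (X q) (Y q)) - g p (lie_bracket Z X p) (Y p)
            - g p (X p) (lie_bracket Z Y p))"

section \<open>Almost contact 3-structures with metrics of Hermitian-Norden type\<close>

definition kronecker :: "nat \<Rightarrow> nat \<Rightarrow> real" where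
  "kronecker \<alpha> \<beta> = (if \<alpha> = \<beta> then 1 else 0)"

definition levi_civita_symbol :: "nat \<Rightarrow> nat \<Rightarrow> nat \<Rightarrow> real" where
  "levi_civita_symbol \<alpha> \<beta> \<gamma> =
     (if (\<alpha>, \<beta>, \<gamma>) \<in> {(1, 2, 3), (2, 3, 1), (3, 1, 2)} then 1
      else if (\<alpha>, \<beta>, \<gamma>) \<in> {(1, 3, 2), (3, 2, 1), (2, 1, 3)} then - 1
      else 0)"

text \<open>The repeated index \<open>\<gamma>\<close> in the classical identities is summed over.\<close>

definition almost_contact_3_structure ::
  "('a, 'e::euclidean_space) atlas \<Rightarrow> (nat \<Rightarrow> 'a \<Rightarrow> 'a tangent \<Rightarrow> 'a tangent)
     \<Rightarrow> (nat \<Rightarrow> 'a vfield) \<Rightarrow> (nat \<Rightarrow> 'a \<Rightarrow> 'a tangent \<Rightarrow> real) \<Rightarrow> bool" where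
  "almost_contact_3_structure A \<phi> \<xi> \<eta> \<longleftrightarrow>
     (\<forall>\<alpha>\<in>{1, 2, 3}. endomorphism_field A (\<phi> \<alpha>) \<and> \<xi> \<alpha> \<in> vector_fields A \<and> one_form A (\<eta> \<alpha>)) \<and>
     (\<forall>\<alpha>\<in>{1, 2, 3}. \<forall>\<beta>\<in>{1, 2, 3}. \<forall>p.
        (\<forall>u\<in>tangent_space A p.
           \<phi> \<alpha> p (\<phi> \<beta> p u) =
             (- kronecker \<alpha> \<beta>) *\<^sub>T u + \<eta> \<beta> p u *\<^sub>T \<xi> \<alpha> p
             + (\<Sum>\<gamma>\<in>{1, 2, 3}. levi_civita_symbol \<alpha> \<beta> \<gamma> *\<^sub>T \<phi> \<gamma> p u)) \<and>
        \<phi> \<alpha> p (\<xi> \<beta> p) = (\<Sum>\<gamma>\<in>{1, 2, 3}. levi_civita_symbol \<alpha> \<beta> \<gamma> *\<^sub>T \<xi> \<gamma> p) \<and>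
        (\<forall>u\<in>tangent_space A p.
           \<eta> \<alpha> p (\<phi> \<beta> p u) = (\<Sum>\<gamma>\<in>{1, 2, 3}. levi_civita_symbol \<alpha> \<beta> \<gamma> * \<eta> \<gamma> p u)) \<and>
        \<eta> \<alpha> p (\<xi> \<beta> p) = kronecker \<alpha> \<beta>)"

definition hn_sign :: "nat \<Rightarrow> real" where
  "hn_sign \<alpha> = (if \<alpha> = 1 then 1 else - 1)"

definition hermitian_norden_metric ::
  "('a, 'e::euclidean_space) atlas \<Rightarrow> (nat \<Rightarrow> 'a \<Rightarrow> 'a tangent \<Rightarrow> 'a tangent)
     \<Rightarrow> (nat \<Rightarrow> 'a \<Rightarrow> 'a tangent \<Rightarrow> real) \<Rightarrow> ('a \<Rightarrow> 'a tangent \<Rightarrow> 'a tangent \<Rightarrow> real) \<Rightarrow> bool" where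
  "hermitian_norden_metric A \<phi> \<eta> g \<longleftrightarrow>
     pseudo_riemannian_metric A g \<and>
     (\<forall>\<alpha>\<in>{1, 2, 3}. \<forall>p. \<forall>u\<in>tangent_space A p. \<forall>v\<in>tangent_space A p.
        g p (\<phi> \<alpha> p u) (\<phi> \<alpha> p v) = hn_sign \<alpha> * g p u v + \<eta> \<alpha> p u * \<eta> \<alpha> p v)"

section \<open>Associated Nijenhuis tensors\<close>

definition sym_bracket ::
  "('a vfield \<Rightarrow> 'a vfield \<Rightarrow> 'a vfield) \<Rightarrow> 'a vfield \<Rightarrow> 'a vfield \<Rightarrow> 'a vfield" where
  "sym_bracket nabla X Y = nabla X Y + nabla Y X"

definition endo_sym_bracket ::
  "('a vfield \<Rightarrow> 'a vfield \<Rightarrow> 'a vfield) \<Rightarrow> ('a \<Rightarrow> 'a tangent \<Rightarrow> 'a tangent)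
     \<Rightarrow> 'a vfield \<Rightarrow> 'a vfield \<Rightarrow> 'a vfield" where
  "endo_sym_bracket nabla \<phi> X Y =
     sym_bracket nabla (apply_field \<phi> X) (apply_field \<phi> Y)
     + apply_field \<phi> (apply_field \<phi> (sym_bracket nabla X Y))
     - apply_field \<phi> (sym_bracket nabla (apply_field \<phi> X) Y)
     - apply_field \<phi> (sym_bracket nabla X (apply_field \<phi> Y))"

definition assoc_nijenhuis ::
  "('a \<Rightarrow> 'a tangent \<Rightarrow> 'a tangent \<Rightarrow> real) \<Rightarrow> ('a vfield \<Rightarrow> 'a vfield \<Rightarrow> 'a vfield)
     \<Rightarrow> (nat \<Rightarrow> 'a \<Rightarrow> 'a tangent \<Rightarrow> 'a tangent) \<Rightarrow> (nat \<Rightarrow> 'a vfield)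
     \<Rightarrow> nat \<Rightarrow> 'a vfield \<Rightarrow> 'a vfield \<Rightarrow> 'a vfield" where
  "assoc_nijenhuis g nabla \<phi> \<xi> \<alpha> X Y =
     endo_sym_bracket nabla (\<phi> \<alpha>) X Y
     - (\<lambda>p. hn_sign \<alpha> * lie_derivative (\<xi> \<alpha>) g X Y p) *\<^sub>F \<xi> \<alpha>"

definition assoc_nijenhuis_vanishes ::
  "('a, 'e::euclidean_space) atlas \<Rightarrow> ('a \<Rightarrow> 'a tangent \<Rightarrow> 'a tangent \<Rightarrow> real)
     \<Rightarrow> ('a vfield \<Rightarrow> 'a vfield \<Rightarrow> 'a vfield)
     \<Rightarrow> (nat \<Rightarrow> 'a \<Rightarrow> 'a tangent \<Rightarrow> 'a tangent) \<Rightarrow> (nat \<Rightarrow> 'a vfield) \<Rightarrow> nat \<Rightarrow> bool" where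
  "assoc_nijenhuis_vanishes A g nabla \<phi> \<xi> \<alpha> \<longleftrightarrow>
     (\<forall>X\<in>vector_fields A. \<forall>Y\<in>vector_fields A. assoc_nijenhuis g nabla \<phi> \<xi> \<alpha> X Y = 0)"

end

theory Submission
  imports Defs
begin

text \<open>
  The associated Nijenhuis tensors are the symmetric counterparts of the tensors that measure
  normality of an almost contact structure. Normality is classically read off from the almost complex
  structure \<open>J (X, a) = (\<phi> X - a \<xi>, \<eta> X)\<close> on \<open>M \<times> \<real>\<close>, where \<open>(X, a)\<close> stands for the field
  \<open>X + a \<partial>\<^sub>t\<close> with coefficients that do not depend on \<open>t\<close>. The same idea works with the Lie bracket
  replaced by the symmetric bracket
  \<open>S ((X, a), (Y, b)) = ({X, Y}, X b + Y a)\<close>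
  on the additive group of pairs of a vector field and a smooth function. Put
  \<open>N\<^sub>J (x, y) = S (J x, J y) - S (x, y) - J S (J x, y) - J S (x, J y)\<close>. Three facts give the result.

  \<^item> The metric condition forces \<open>g (\<xi>, X) = - \<epsilon> \<eta> (X)\<close>, and since the Levi-Civita connection is metric
    and torsion free this turns \<open>- \<epsilon> \<L>\<^sub>\<xi> g\<close> into \<open>X (\<eta> Y) + Y (\<eta> X) - \<eta> {X, Y}\<close>. So the associated
    Nijenhuis tensor of \<open>\<phi>\<close> at \<open>(X, Y)\<close> is the vector field component of \<open>N\<^sub>J ((X, 0), (Y, 0))\<close>:
    \<open>assoc_nijenhuis_horizontal\<close>.

  \<^item> If this component vanishes for all \<open>X\<close> and \<open>Y\<close>, then \<open>N\<^sub>J = 0\<close>: \<open>nijenhuis_vanishes\<close>. The reason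
    is that \<open>N\<^sub>J\<close> is antilinear over \<open>J\<close> in each argument, while \<open>J\<close> mixes the two components and
    carries \<open>(b \<xi>, 0)\<close> to \<open>(0, b)\<close>.

  \<^item> The three structures \<open>J\<close> of an almost contact 3-structure multiply like the quaternion units,
    and for anticommuting complex structures \<open>I\<close>, \<open>J\<close> and any biadditive bracket, \<open>N\<^sub>I = 0\<close> and
    \<open>N\<^sub>J = 0\<close> imply \<open>N\<^sub>I\<^sub>J = 0\<close>: \<open>nijenhuis_compose_vanishes\<close>. Indeed, they give
    \<open>N\<^sub>I\<^sub>J = - I J M\<close> with an expression \<open>M\<close> symmetric in \<open>I\<close> and \<open>J\<close>. Exchanging \<open>I\<close> and \<open>J\<close>
    changes the sign of the right-hand side but not \<open>N\<^sub>I\<^sub>J = N\<^sub>J\<^sub>I\<close>, so \<open>N\<^sub>I\<^sub>J = - N\<^sub>I\<^sub>J\<close>.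
\<close>

section \<open>Nijenhuis operators of a biadditive bracket\<close>

text \<open>
  The bracket lives on a subgroup \<open>V\<close> of a group type, since vector fields and smooth functions
  are subgroups of types that contain much more.
\<close>

locale biadditive_bracket =
  fixes V :: "'v::ab_group_add set" and S :: "'v \<Rightarrow> 'v \<Rightarrow> 'v"
  assumes add_closed: "x \<in> V \<Longrightarrow> y \<in> V \<Longrightarrow> x + y \<in> V"
    and uminus_closed: "x \<in> V \<Longrightarrow> - x \<in> V"
    and bracket_closed: "x \<in> V \<Longrightarrow> y \<in> V \<Longrightarrow> S x y \<in> V"
    and bracket_add_left: "x \<in> V \<Longrightarrow> x' \<in> V \<Longrightarrow> y \<in> V \<Longrightarrow> S (x + x') y = S x y + S x' y"
    and bracket_add_right: "x \<in> V \<Longrightarrow> y \<in> V \<Longrightarrow> y' \<in> V \<Longrightarrow> S x (y + y') = S x y + S x y'"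
begin

definition nijenhuis :: "('v \<Rightarrow> 'v) \<Rightarrow> 'v \<Rightarrow> 'v \<Rightarrow> 'v" where
  "nijenhuis J x y = S (J x) (J y) - S x y - J (S (J x) y) - J (S x (J y))"

definition complex_structure :: "('v \<Rightarrow> 'v) \<Rightarrow> bool" where
  "complex_structure J \<longleftrightarrow>
     (\<forall>x\<in>V. J x \<in> V) \<and> (\<forall>x\<in>V. \<forall>y\<in>V. J (x + y) = J x + J y) \<and> (\<forall>x\<in>V. J (J x) = - x)"

lemma diff_closed: "x \<in> V \<Longrightarrow> y \<in> V \<Longrightarrow> x - y \<in> V"
  using add_closed[of x "- y"] uminus_closed by simp

lemma additive_uminus:
  fixes f :: "'v \<Rightarrow> 'w::ab_group_add"
  assumes "\<And>x y. x \<in> V \<Longrightarrow> y \<in> V \<Longrightarrow> f (x + y) = f x + f y" and "x \<in> V"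
  shows "f (- x) = - f x"
proof -
  have "0 \<in> V"
    using add_closed[of x "- x"] uminus_closed assms(2) by simp
  hence "f 0 = 0"
    using assms(1)[of 0 0] by simp
  thus ?thesis
    using assms(1)[of x "- x"] uminus_closed assms(2) by (simp add: eq_neg_iff_add_eq_0 add.commute)
qed

lemma bracket_uminus_left: "x \<in> V \<Longrightarrow> y \<in> V \<Longrightarrow> S (- x) y = - S x y"
  by (rule additive_uminus) (auto simp: bracket_add_left)

lemma bracket_uminus_right: "x \<in> V \<Longrightarrow> y \<in> V \<Longrightarrow> S x (- y) = - S x y"
  by (rule additive_uminus) (auto simp: bracket_add_right)

context
  fixes J assumes J: "complex_structure J"
begin

lemma complex_structure_closed: "x \<in> V \<Longrightarrow> J x \<in> V"
  and complex_structure_add: "x \<in> V \<Longrightarrow> y \<in> V \<Longrightarrow> J (x + y) = J x + J y"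
  and complex_structure_square: "x \<in> V \<Longrightarrow> J (J x) = - x"
  using J by (auto simp: complex_structure_def)

lemma complex_structure_uminus: "x \<in> V \<Longrightarrow> J (- x) = - J x"
  by (rule additive_uminus) (auto simp: complex_structure_add)

lemma complex_structure_diff: "x \<in> V \<Longrightarrow> y \<in> V \<Longrightarrow> J (x - y) = J x - J y"
  using complex_structure_add[of x "- y"] complex_structure_uminus uminus_closed by simp

lemma nijenhuis_add_left:
  assumes "x \<in> V" "x' \<in> V" "y \<in> V"
  shows "nijenhuis J (x + x') y = nijenhuis J x y + nijenhuis J x' y"
  using assms
  by (simp add: nijenhuis_def complex_structure_add complex_structure_closed bracket_add_left
      bracket_closed add_closed algebra_simps)

lemma nijenhuis_add_right:
  assumes "x \<in> V" "y \<in> V" "y' \<in> V"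
  shows "nijenhuis J x (y + y') = nijenhuis J x y + nijenhuis J x y'"
  using assms
  by (simp add: nijenhuis_def complex_structure_add complex_structure_closed bracket_add_right
      bracket_closed add_closed algebra_simps)

text \<open>
  Replacing \<open>x\<close> by \<open>J x\<close> in the four terms of the Nijenhuis operator permutes them up to sign and
  a factor \<open>J\<close>, because \<open>J\<^sup>2 = - 1\<close>. For the bracket of a connection, which is not linear over
  functions, this property takes the place of linearity over functions.
\<close>

lemma nijenhuis_antilinear_left:
  assumes "x \<in> V" "y \<in> V"
  shows "nijenhuis J (J x) y = - J (nijenhuis J x y)"
  using assms
  by (simp add: nijenhuis_def complex_structure_diff complex_structure_closed diff_closed
      bracket_closed complex_structure_square complex_structure_uminus bracket_uminus_left)

lemma nijenhuis_antilinear_right: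
  assumes "x \<in> V" "y \<in> V"
  shows "nijenhuis J x (J y) = - J (nijenhuis J x y)"
  using assms
  by (simp add: nijenhuis_def complex_structure_diff complex_structure_closed diff_closed
      bracket_closed complex_structure_square complex_structure_uminus bracket_uminus_right)

end

text \<open>
  For complex structures, \<open>- S x y\<close> in the Nijenhuis operator is \<open>J (J (S x y))\<close>, which makes the
  operator quadratic in \<open>J\<close>. This is its polarization for anticommuting \<open>I\<close> and \<open>J\<close>, for which the
  terms \<open>I (J (S x y))\<close> and \<open>J (I (S x y))\<close> cancel.
\<close>

definition mixed_nijenhuis :: "('v \<Rightarrow> 'v) \<Rightarrow> ('v \<Rightarrow> 'v) \<Rightarrow> 'v \<Rightarrow> 'v \<Rightarrow> 'v" where
  "mixed_nijenhuis I J x y = S (I x) (J y) + S (J x) (I y)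
     - I (S (J x) y + S x (J y)) - J (S (I x) y + S x (I y))"

text \<open>
  The identity holds term by term: the relation for \<open>I\<close> at \<open>(J x, J y)\<close> followed by the one for \<open>J\<close>
  at \<open>(x, y)\<close> removes \<open>S (I J x) (I J y)\<close>. The relations for \<open>J\<close> at \<open>(I x, y)\<close> and \<open>(x, I y)\<close> then
  trade \<open>S (I J x) (J y)\<close> and \<open>S (J x) (I J y)\<close>, which do not occur in the mixed operator, for terms
  that do and for \<open>S (I J x) y\<close> and \<open>S x (I J y)\<close>, which cancel in the operator of \<open>I J\<close>.
\<close>

lemma nijenhuis_compose:
  assumes I: "complex_structure I" and J: "complex_structure J"
    and anti: "\<And>x. x \<in> V \<Longrightarrow> J (I x) = - I (J x)"
    and NI: "\<And>x y. x \<in> V \<Longrightarrow> y \<in> V \<Longrightarrow> nijenhuis I x y = 0"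
    and NJ: "\<And>x y. x \<in> V \<Longrightarrow> y \<in> V \<Longrightarrow> nijenhuis J x y = 0"
    and x: "x \<in> V" and y: "y \<in> V"
  shows "nijenhuis (\<lambda>z. I (J z)) x y = - I (J (mixed_nijenhuis I J x y))"
proof -
  note cl = bracket_closed complex_structure_closed[OF I] complex_structure_closed[OF J]
    add_closed diff_closed uminus_closed x y
  note lin = complex_structure_add[OF I] complex_structure_add[OF J]
    complex_structure_diff[OF I] complex_structure_diff[OF J]
    complex_structure_uminus[OF I] complex_structure_uminus[OF J]
    complex_structure_square[OF I] complex_structure_square[OF J]
    bracket_uminus_left bracket_uminus_right
  have eI: "S (I (J x)) (I (J y)) = S (J x) (J y) + I (S (I (J x)) (J y)) + I (S (J x) (I (J y)))"
    using NI[of "J x" "J y"] by (simp add: nijenhuis_def cl algebra_simps)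
  have eJ: "S (J x) (J y) = S x y + J (S (J x) y) + J (S x (J y))"
    using NJ[of x y] by (simp add: nijenhuis_def cl algebra_simps)
  have left: "J (S (I x) (J y)) = J (S (I (J x)) y) - S (I (J x)) (J y) - S (I x) y"
    using NJ[of "I x" y] by (simp add: nijenhuis_def cl anti lin algebra_simps)
  have right: "J (S (J x) (I y)) = J (S x (I (J y))) - S (J x) (I (J y)) - S x (I y)"
    using NJ[of x "I y"] by (simp add: nijenhuis_def cl anti lin algebra_simps)
  show ?thesis
    unfolding nijenhuis_def mixed_nijenhuis_def eI eJ
    by (simp add: cl lin anti left right algebra_simps)
qed

text \<open>
  The Nijenhuis operator does not see the sign of a structure, so it is the same for \<open>I J\<close> and
  \<open>J I = - I J\<close>; but the expression found for it in the previous lemma changes sign when \<open>I\<close> and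
  \<open>J\<close> are exchanged.
\<close>

lemma nijenhuis_compose_vanishes:
  assumes I: "complex_structure I" and J: "complex_structure J"
    and anti: "\<And>x. x \<in> V \<Longrightarrow> J (I x) = - I (J x)"
    and NI: "\<And>x y. x \<in> V \<Longrightarrow> y \<in> V \<Longrightarrow> nijenhuis I x y = 0"
    and NJ: "\<And>x y. x \<in> V \<Longrightarrow> y \<in> V \<Longrightarrow> nijenhuis J x y = 0"
    and two_torsion_free: "\<And>z :: 'v. z + z = 0 \<Longrightarrow> z = 0"
    and x: "x \<in> V" and y: "y \<in> V"
  shows "nijenhuis (\<lambda>z. I (J z)) x y = 0"
proof -
  have anti': "I (J z) = - J (I z)" if "z \<in> V" for z
    using anti that by simp
  have cl: "mixed_nijenhuis I J x y \<in> V"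
    unfolding mixed_nijenhuis_def
    by (intro diff_closed add_closed bracket_closed complex_structure_closed[OF I]
        complex_structure_closed[OF J] x y)
  have "nijenhuis (\<lambda>z. I (J z)) x y = nijenhuis (\<lambda>z. J (I z)) x y"
    by (simp add: nijenhuis_def anti x y bracket_uminus_left bracket_uminus_right bracket_closed
        complex_structure_closed[OF I] complex_structure_closed[OF J] uminus_closed
        complex_structure_uminus[OF I] complex_structure_uminus[OF J])
  also have "\<dots> = - J (I (mixed_nijenhuis J I x y))"
    by (rule nijenhuis_compose[OF J I anti' NJ NI x y])
  also have "mixed_nijenhuis J I x y = mixed_nijenhuis I J x y"
    by (simp add: mixed_nijenhuis_def algebra_simps)
  also have "- J (I (mixed_nijenhuis I J x y)) = - nijenhuis (\<lambda>z. I (J z)) x y"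
    using nijenhuis_compose[OF I J anti NI NJ x y] anti[OF cl] by simp
  finally show ?thesis
    using two_torsion_free[of "nijenhuis (\<lambda>z. I (J z)) x y"] by (simp add: eq_neg_iff_add_eq_0)
qed

end

section \<open>Smooth functions and vector fields\<close>

text \<open>
  Iterated derivatives of \<open>f\<close> at points of an open set depend only on the values of \<open>f\<close> there. This
  is needed because the formulas for derivatives of sums and products hold only on the set where the
  functions are known to be differentiable.
\<close>

lemma diff_of_order_on_cong:
  assumes "open S" "diff_of_order_on k S f" "\<And>x. x \<in> S \<Longrightarrow> f x = g x"
  shows "diff_of_order_on k S g"
  using assms
proof (induction k arbitrary: f g)
  case 0
  then show ?case
    using continuous_on_cong by force
next
  case (Suc k)
  have deriv: "(g has_derivative frechet_derivative f (at x)) (at x)" if "x \<in> S" for x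
    using Suc.prems that
    by (auto intro: has_derivative_transform_within_open[of f _ x UNIV S]
        simp flip: frechet_derivative_works)
  have eq: "frechet_derivative f (at x) = frechet_derivative g (at x)" if "x \<in> S" for x
    using frechet_derivative_at[OF deriv[OF that]] .
  have "diff_of_order_on k S (\<lambda>x. frechet_derivative g (at x) v)" for v
  proof (rule Suc.IH[OF assms(1)])
    show "diff_of_order_on k S (\<lambda>x. frechet_derivative f (at x) v)"
      using Suc.prems by simp
  qed (simp add: eq)
  with differentiableI[OF deriv] show ?case
    by simp
qed

lemma diff_of_order_on_Suc_imp: "diff_of_order_on (Suc k) S f \<Longrightarrow> diff_of_order_on k S f"
proof (induction k arbitrary: f)
  case 0
  then show ?case
    by (auto intro!: continuous_at_imp_continuous_on differentiable_imp_continuous_within)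
next
  case (Suc k)
  have "diff_of_order_on k S (\<lambda>x. frechet_derivative f (at x) v)" for v
    using Suc.prems by (intro Suc.IH) (simp only: diff_of_order_on.simps(2)[of "Suc k"])
  with Suc.prems show ?case
    by simp
qed

lemma diff_of_order_on_add:
  assumes "open S" "diff_of_order_on k S f" "diff_of_order_on k S g"
  shows "diff_of_order_on k S (\<lambda>x. f x + g x)"
  using assms(2,3)
proof (induction k arbitrary: f g)
  case 0
  then show ?case
    by (auto intro: continuous_on_add)
next
  case (Suc k)
  have deriv: "((\<lambda>x. f x + g x) has_derivative
      (\<lambda>v. frechet_derivative f (at x) v + frechet_derivative g (at x) v)) (at x)" if "x \<in> S" for x
    using Suc.prems that by (intro has_derivative_add) (auto simp flip: frechet_derivative_works)
  have eq: "frechet_derivative f (at x) v + frechet_derivative g (at x) v =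
      frechet_derivative (\<lambda>x. f x + g x) (at x) v" if "x \<in> S" for x v
    using fun_cong[OF frechet_derivative_at[OF deriv[OF that]]] .
  have "diff_of_order_on k S
      (\<lambda>x. frechet_derivative f (at x) v + frechet_derivative g (at x) v)" for v
    using Suc.prems by (intro Suc.IH) auto
  hence "diff_of_order_on k S (\<lambda>x. frechet_derivative (\<lambda>x. f x + g x) (at x) v)" for v
    by (rule diff_of_order_on_cong[OF assms(1) _ eq])
  with differentiableI[OF deriv] show ?case
    by simp
qed

lemma diff_of_order_on_mult:
  fixes f g :: "'e::euclidean_space \<Rightarrow> real"
  assumes "open S" "diff_of_order_on k S f" "diff_of_order_on k S g"
  shows "diff_of_order_on k S (\<lambda>x. f x * g x)"
  using assms(2,3)
proof (induction k arbitrary: f g)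
  case 0
  then show ?case
    by (auto intro: continuous_on_mult)
next
  case (Suc k)
  have deriv: "((\<lambda>x. f x * g x) has_derivative
      (\<lambda>v. f x * frechet_derivative g (at x) v + frechet_derivative f (at x) v * g x)) (at x)"
    if "x \<in> S" for x
    using Suc.prems that by (intro has_derivative_mult) (auto simp flip: frechet_derivative_works)
  have eq: "f x * frechet_derivative g (at x) v + frechet_derivative f (at x) v * g x =
      frechet_derivative (\<lambda>x. f x * g x) (at x) v" if "x \<in> S" for x v
    using fun_cong[OF frechet_derivative_at[OF deriv[OF that]]] .
  have "diff_of_order_on k S
      (\<lambda>x. f x * frechet_derivative g (at x) v + frechet_derivative f (at x) v * g x)" for v
  proof (intro diff_of_order_on_add[OF assms(1)] Suc.IH)
    show "diff_of_order_on k S f" "diff_of_order_on k S g"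
      using Suc.prems diff_of_order_on_Suc_imp by blast+
  qed (use Suc.prems in auto)
  hence "diff_of_order_on k S (\<lambda>x. frechet_derivative (\<lambda>x. f x * g x) (at x) v)" for v
    by (rule diff_of_order_on_cong[OF assms(1) _ eq])
  with differentiableI[OF deriv] show ?case
    by simp
qed

lemma diff_of_order_on_const: "diff_of_order_on k S (\<lambda>x. c)"
  by (induction k arbitrary: c) (auto simp: frechet_derivative_const)

locale manifold =
  fixes A :: "('a::{t2_space, second_countable_topology}, 'e::euclidean_space) atlas"
  assumes manifold: "smooth_manifold A"
begin

lemma chart_image_open: "(U, c) \<in> A \<Longrightarrow> open (c ` U)"
  using manifold by (auto simp: smooth_manifold_def)

lemma smooth_add:
  assumes "f \<in> smooth_functions A" "h \<in> smooth_functions A"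
  shows "(\<lambda>q. f q + h q) \<in> smooth_functions A"
proof -
  have "diff_of_order_on k (c ` U) (\<lambda>x. f (inv_into U c x) + h (inv_into U c x))"
    if "(U, c) \<in> A" for U c k
    using assms that
    by (intro diff_of_order_on_add chart_image_open)
      (auto simp: smooth_functions_def smooth_on_def comp_def)
  thus ?thesis
    by (auto simp: smooth_functions_def smooth_on_def comp_def)
qed

lemma smooth_mult:
  assumes "f \<in> smooth_functions A" "h \<in> smooth_functions A"
  shows "(\<lambda>q. f q * h q) \<in> smooth_functions A"
proof -
  have "diff_of_order_on k (c ` U) (\<lambda>x. f (inv_into U c x) * h (inv_into U c x))"
    if "(U, c) \<in> A" for U c k
    using assms that
    by (intro diff_of_order_on_mult chart_image_open)
      (auto simp: smooth_functions_def smooth_on_def comp_def)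
  thus ?thesis
    by (auto simp: smooth_functions_def smooth_on_def comp_def)
qed

lemma smooth_const: "(\<lambda>q. r) \<in> smooth_functions A"
  by (auto simp: smooth_functions_def smooth_on_def comp_def diff_of_order_on_const)

lemma smooth_minus: "f \<in> smooth_functions A \<Longrightarrow> (\<lambda>q. - f q) \<in> smooth_functions A"
  using smooth_mult[OF smooth_const[of "- 1"]] by fastforce

lemma tangent_add: "v \<in> tangent_space A p \<Longrightarrow> f \<in> smooth_functions A \<Longrightarrow> h \<in> smooth_functions A
    \<Longrightarrow> v (\<lambda>q. f q + h q) = v f + v h"
  and tangent_scale: "v \<in> tangent_space A p \<Longrightarrow> f \<in> smooth_functions A \<Longrightarrow> v (\<lambda>q. r * f q) = r * v f"
  and tangent_mult: "v \<in> tangent_space A p \<Longrightarrow> f \<in> smooth_functions A \<Longrightarrow> h \<in> smooth_functions A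
    \<Longrightarrow> v (\<lambda>q. f q * h q) = f p * v h + h p * v f"
  by (auto simp: tangent_space_def)

lemma tangent_const:
  assumes "v \<in> tangent_space A p"
  shows "v (\<lambda>q. r) = 0"
  using tangent_mult[OF assms smooth_const[of 1] smooth_const[of 1]]
    tangent_scale[OF assms smooth_const[of 1], of r] by simp

lemma tangent_space_add: "u \<in> tangent_space A p \<Longrightarrow> v \<in> tangent_space A p \<Longrightarrow> u + v \<in> tangent_space A p"
  unfolding tangent_space_def by (auto simp: algebra_simps)

lemma tangent_space_scale: "u \<in> tangent_space A p \<Longrightarrow> r *\<^sub>T u \<in> tangent_space A p"
  unfolding tangent_space_def tscale_def by (auto simp: algebra_simps)

lemma vector_field_tangent: "X \<in> vector_fields A \<Longrightarrow> X p \<in> tangent_space A p"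
  and vector_field_smooth: "X \<in> vector_fields A \<Longrightarrow> f \<in> smooth_functions A \<Longrightarrow> deriv_along X f \<in> smooth_functions A"
  by (auto simp: vector_fields_def)

lemma vector_field_add: "X \<in> vector_fields A \<Longrightarrow> Y \<in> vector_fields A \<Longrightarrow> X + Y \<in> vector_fields A"
  using smooth_add unfolding vector_fields_def deriv_along_def
  by (auto simp: tangent_space_add)

lemma vector_field_scale: "h \<in> smooth_functions A \<Longrightarrow> X \<in> vector_fields A \<Longrightarrow> h *\<^sub>F X \<in> vector_fields A"
  using smooth_mult unfolding vector_fields_def deriv_along_def fscale_def
  by (auto simp: tangent_space_scale) (auto simp: tscale_def)

lemma uminus_vector_field_eq: "- X = (\<lambda>p. - 1) *\<^sub>F X"
  by (auto simp: fscale_def tscale_def fun_eq_iff)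

lemma vector_field_uminus: "X \<in> vector_fields A \<Longrightarrow> - X \<in> vector_fields A"
  unfolding uminus_vector_field_eq by (intro vector_field_scale smooth_const)

end

section \<open>The bracket of a connection on vector fields with an additional function\<close>

lemma fscale_zero: "0 *\<^sub>F X = 0"
  by (simp add: fscale_def tscale_def fun_eq_iff)

lemma (in manifold) tangent_diff: "u - v = u + (- 1) *\<^sub>T v"
  by (simp add: tscale_def fun_eq_iff)

lemma (in manifold) tangent_space_diff:
  "u \<in> tangent_space A p \<Longrightarrow> v \<in> tangent_space A p \<Longrightarrow> u - v \<in> tangent_space A p"
  unfolding tangent_diff by (intro tangent_space_add tangent_space_scale)

text \<open>
  With \<open>(X, a)\<close> read as the field \<open>X + a \<partial>\<^sub>t\<close> on \<open>M \<times> \<real>\<close>, this is the symmetric bracket of the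
  product of the given connection with the flat connection of \<open>\<real>\<close>.
\<close>

definition ext_bracket ::
  "('a vfield \<Rightarrow> 'a vfield \<Rightarrow> 'a vfield) \<Rightarrow> 'a vfield \<times> ('a \<Rightarrow> real)
     \<Rightarrow> 'a vfield \<times> ('a \<Rightarrow> real) \<Rightarrow> 'a vfield \<times> ('a \<Rightarrow> real)" where
  "ext_bracket nabla =
     (\<lambda>(X, a) (Y, b). (sym_bracket nabla X Y, deriv_along X b + deriv_along Y a))"

text \<open>The almost complex structure on \<open>M \<times> \<real>\<close> that is attached to an almost contact structure.\<close>

definition ext_endomorphism ::
  "('a \<Rightarrow> 'a tangent \<Rightarrow> 'a tangent) \<Rightarrow> 'a vfield \<Rightarrow> ('a \<Rightarrow> 'a tangent \<Rightarrow> real)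
     \<Rightarrow> 'a vfield \<times> ('a \<Rightarrow> real) \<Rightarrow> 'a vfield \<times> ('a \<Rightarrow> real)" where
  "ext_endomorphism \<phi> \<xi> \<eta> = (\<lambda>(X, a). (apply_field \<phi> X - a *\<^sub>F \<xi>, \<lambda>p. \<eta> p (X p)))"

lemma ext_bracket_commute: "ext_bracket nabla x y = ext_bracket nabla y x"
  by (cases x; cases y) (simp add: ext_bracket_def sym_bracket_def add.commute)

locale manifold_connection = manifold A
  for A :: "('a::{t2_space, second_countable_topology}, 'e::euclidean_space) atlas" +
  fixes nabla :: "'a vfield \<Rightarrow> 'a vfield \<Rightarrow> 'a vfield"
  assumes connection: "affine_connection A nabla"
begin

lemma nabla_closed: "X \<in> vector_fields A \<Longrightarrow> Y \<in> vector_fields A \<Longrightarrow> nabla X Y \<in> vector_fields A"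
  and nabla_add_left: "X \<in> vector_fields A \<Longrightarrow> X' \<in> vector_fields A \<Longrightarrow> Y \<in> vector_fields A
    \<Longrightarrow> nabla (X + X') Y = nabla X Y + nabla X' Y"
  and nabla_add_right: "X \<in> vector_fields A \<Longrightarrow> Y \<in> vector_fields A \<Longrightarrow> Y' \<in> vector_fields A
    \<Longrightarrow> nabla X (Y + Y') = nabla X Y + nabla X Y'"
  using connection by (auto simp: affine_connection_def)

lemma sym_bracket_closed:
  "X \<in> vector_fields A \<Longrightarrow> Y \<in> vector_fields A \<Longrightarrow> sym_bracket nabla X Y \<in> vector_fields A"
  by (simp add: sym_bracket_def vector_field_add nabla_closed)

lemma deriv_along_add:
  "X \<in> vector_fields A \<Longrightarrow> a \<in> smooth_functions A \<Longrightarrow> b \<in> smooth_functions A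
    \<Longrightarrow> deriv_along X (a + b) = deriv_along X a + deriv_along X b"
  using tangent_add[OF vector_field_tangent] by (auto simp: deriv_along_def plus_fun_def fun_eq_iff)

lemma deriv_along_0: "X \<in> vector_fields A \<Longrightarrow> deriv_along X 0 = 0"
  using tangent_const[OF vector_field_tangent, of X _ 0]
  by (simp add: deriv_along_def zero_fun_def)

sublocale ext: biadditive_bracket "vector_fields A \<times> smooth_functions A" "ext_bracket nabla"
proof
  fix x y :: "'a vfield \<times> ('a \<Rightarrow> real)"
  assume xy: "x \<in> vector_fields A \<times> smooth_functions A" "y \<in> vector_fields A \<times> smooth_functions A"
  thus "x + y \<in> vector_fields A \<times> smooth_functions A"
    using smooth_add by (cases x; cases y) (auto simp: vector_field_add plus_fun_def[of "_::'a \<Rightarrow> real"])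
  show "ext_bracket nabla x y \<in> vector_fields A \<times> smooth_functions A"
    using xy smooth_add vector_field_smooth
    by (cases x; cases y)
      (auto simp: ext_bracket_def sym_bracket_closed plus_fun_def[of "_::'a \<Rightarrow> real"])
  fix x' assume x': "x' \<in> vector_fields A \<times> smooth_functions A"
  show add: "ext_bracket nabla (x + x') y = ext_bracket nabla x y + ext_bracket nabla x' y"
    using xy x' nabla_add_left nabla_add_right deriv_along_add
    by (cases x; cases x'; cases y)
      (auto simp: ext_bracket_def sym_bracket_def, simp add: deriv_along_def fun_eq_iff)
  thus "ext_bracket nabla y (x + x') = ext_bracket nabla y x + ext_bracket nabla y x'"
    by (simp only: ext_bracket_commute[of nabla y])
next
  fix x assume "x \<in> vector_fields A \<times> smooth_functions A"
  thus "- x \<in> vector_fields A \<times> smooth_functions A"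
    using smooth_minus by (cases x) (auto simp: vector_field_uminus fun_Compl_def[of "_ :: 'a \<Rightarrow> real"])
qed

end

section \<open>One almost contact structure\<close>

locale almost_contact = manifold_connection A nabla
  for A :: "('a::{t2_space, second_countable_topology}, 'e::euclidean_space) atlas" and nabla +
  fixes \<phi> :: "'a \<Rightarrow> 'a tangent \<Rightarrow> 'a tangent" and \<xi> :: "'a vfield"
    and \<eta> :: "'a \<Rightarrow> 'a tangent \<Rightarrow> real"
  assumes endo: "endomorphism_field A \<phi>"
    and reeb: "\<xi> \<in> vector_fields A"
    and form: "one_form A \<eta>"
    and endo_square: "u \<in> tangent_space A p \<Longrightarrow> \<phi> p (\<phi> p u) = \<eta> p u *\<^sub>T \<xi> p - u"
    and endo_reeb: "\<phi> p (\<xi> p) = 0"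
    and form_endo: "u \<in> tangent_space A p \<Longrightarrow> \<eta> p (\<phi> p u) = 0"
    and form_reeb: "\<eta> p (\<xi> p) = 1"
begin

abbreviation "J \<equiv> ext_endomorphism \<phi> \<xi> \<eta>"

lemma endo_tangent: "u \<in> tangent_space A p \<Longrightarrow> \<phi> p u \<in> tangent_space A p"
  and endo_add: "u \<in> tangent_space A p \<Longrightarrow> v \<in> tangent_space A p \<Longrightarrow> \<phi> p (u + v) = \<phi> p u + \<phi> p v"
  and endo_scale: "u \<in> tangent_space A p \<Longrightarrow> \<phi> p (r *\<^sub>T u) = r *\<^sub>T \<phi> p u"
  and endo_field: "X \<in> vector_fields A \<Longrightarrow> apply_field \<phi> X \<in> vector_fields A"
  using endo by (auto simp: endomorphism_field_def apply_field_def)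

lemma form_add: "u \<in> tangent_space A p \<Longrightarrow> v \<in> tangent_space A p \<Longrightarrow> \<eta> p (u + v) = \<eta> p u + \<eta> p v"
  and form_scale: "u \<in> tangent_space A p \<Longrightarrow> \<eta> p (r *\<^sub>T u) = r * \<eta> p u"
  and form_smooth: "X \<in> vector_fields A \<Longrightarrow> (\<lambda>p. \<eta> p (X p)) \<in> smooth_functions A"
  using form by (auto simp: one_form_def)

lemma reeb_tangent: "\<xi> p \<in> tangent_space A p"
  by (rule vector_field_tangent[OF reeb])

lemma tangent_diff_scale: "u - r *\<^sub>T v = u + (- r) *\<^sub>T v"
  by (auto simp: tscale_def fun_eq_iff)

lemma endo_diff_reeb: "u \<in> tangent_space A p \<Longrightarrow> \<phi> p (u - r *\<^sub>T \<xi> p) = \<phi> p u"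
  unfolding tangent_diff_scale
  by (simp add: endo_add endo_scale endo_reeb tangent_space_scale reeb_tangent)
    (simp add: tscale_def fun_eq_iff)

lemma form_diff_reeb: "u \<in> tangent_space A p \<Longrightarrow> \<eta> p (u - r *\<^sub>T \<xi> p) = \<eta> p u - r"
  unfolding tangent_diff_scale
  by (simp add: form_add form_scale form_reeb tangent_space_scale reeb_tangent)

lemma ext_complex_structure: "ext.complex_structure J"
  unfolding ext.complex_structure_def
proof (intro conjI ballI)
  fix x y :: "'a vfield \<times> ('a \<Rightarrow> real)"
  assume x: "x \<in> vector_fields A \<times> smooth_functions A"
  obtain X a where X: "x = (X, a)" "X \<in> vector_fields A" "a \<in> smooth_functions A"
    using x by auto
  have "apply_field \<phi> X + - (a *\<^sub>F \<xi>) \<in> vector_fields A"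
    using X by (intro vector_field_add vector_field_uminus endo_field vector_field_scale reeb)
  thus "J x \<in> vector_fields A \<times> smooth_functions A"
    using X form_smooth by (simp add: ext_endomorphism_def)
  note tan = vector_field_tangent[OF X(2)]
  show "J (J x) = - x"
    using X
    by (auto simp: ext_endomorphism_def apply_field_def fscale_def fun_eq_iff endo_diff_reeb
        form_diff_reeb endo_square tan endo_tangent form_endo)
  assume y: "y \<in> vector_fields A \<times> smooth_functions A"
  obtain Y b where Y: "y = (Y, b)" "Y \<in> vector_fields A"
    using y by auto
  show "J (x + y) = J x + J y"
    using X Y tan vector_field_tangent[OF Y(2)]
    by (auto simp: ext_endomorphism_def apply_field_def fscale_def tscale_def fun_eq_iff endo_add form_add
        algebra_simps)
qed

text \<open>
  Functions in the second component thus arise by applying \<open>J\<close> to multiples of \<open>\<xi>\<close> in the first one;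
  antilinearity of the Nijenhuis operator then transports statements about vector fields to pairs.
\<close>

lemma ext_endomorphism_vertical: "J (b *\<^sub>F \<xi>, 0) = (0, b)"
  by (auto simp: ext_endomorphism_def apply_field_def fscale_def fun_eq_iff endo_scale form_scale
      reeb_tangent endo_reeb form_reeb) (auto simp: tscale_def)

lemma zero_vector_field: "0 \<in> vector_fields A"
  using vector_field_add[OF reeb vector_field_uminus[OF reeb]] by simp

lemma zero_smooth: "0 \<in> smooth_functions A"
  using smooth_const[of 0] by (simp add: zero_fun_def)

lemma fst_nijenhuis_horizontal:
  assumes "X \<in> vector_fields A" "Y \<in> vector_fields A"
  shows "fst (ext.nijenhuis J (X, 0) (Y, 0)) =
    sym_bracket nabla (apply_field \<phi> X) (apply_field \<phi> Y) - sym_bracket nabla X Y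
    - apply_field \<phi> (sym_bracket nabla (apply_field \<phi> X) Y)
    - apply_field \<phi> (sym_bracket nabla X (apply_field \<phi> Y))
    + (deriv_along X (\<lambda>p. \<eta> p (Y p)) + deriv_along Y (\<lambda>p. \<eta> p (X p))) *\<^sub>F \<xi>"
  using assms unfolding ext.nijenhuis_def
  by (simp add: ext_bracket_def ext_endomorphism_def deriv_along_0 endo_field fscale_zero)
    (simp add: fun_eq_iff fscale_def tscale_def algebra_simps)

lemma snd_nijenhuis_horizontal:
  assumes "X \<in> vector_fields A" "Y \<in> vector_fields A"
  shows "snd (ext.nijenhuis J (X, 0) (Y, 0)) =
    deriv_along (apply_field \<phi> X) (\<lambda>p. \<eta> p (Y p)) + deriv_along (apply_field \<phi> Y) (\<lambda>p. \<eta> p (X p))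
    - (\<lambda>p. \<eta> p (sym_bracket nabla (apply_field \<phi> X) Y p))
    - (\<lambda>p. \<eta> p (sym_bracket nabla X (apply_field \<phi> Y) p))"
  using assms unfolding ext.nijenhuis_def
  by (simp add: ext_bracket_def ext_endomorphism_def deriv_along_0 endo_field fscale_zero)


text \<open>
  Let \<open>n X Y\<close> be the function component of the operator at \<open>(X, 0)\<close>, \<open>(Y, 0)\<close>. In the decomposition
  \<open>J (X, 0) = (\<phi> X, 0) + J (\<eta>(X) \<xi>, 0)\<close>, the vector field component of the operator at
  \<open>(\<phi> X, 0)\<close>, \<open>(Y, 0)\<close> is zero, and antilinearity gives \<open>n X Y = n (\<eta>(X) \<xi>) Y\<close>. By symmetry of the
  bracket the second argument can be replaced likewise, and \<open>n (a \<xi>) (b \<xi>) = 0\<close> because every term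
  of \<open>n\<close> contains \<open>\<phi> X\<close> or \<open>\<phi> Y\<close>, and \<open>\<phi> \<xi> = 0\<close>. So the operator vanishes on pairs \<open>(X, 0)\<close>, and
  by antilinearity on their images under \<open>J\<close>, which include all \<open>(0, a)\<close>.
\<close>

lemma nijenhuis_vanishes:
  assumes fst0: "\<And>X Y. X \<in> vector_fields A \<Longrightarrow> Y \<in> vector_fields A
      \<Longrightarrow> fst (ext.nijenhuis J (X, 0) (Y, 0)) = 0"
    and x: "x \<in> vector_fields A \<times> smooth_functions A"
    and y: "y \<in> vector_fields A \<times> smooth_functions A"
  shows "ext.nijenhuis J x y = 0"
proof -
  note closed = endo_field vector_field_scale[OF _ reeb] form_smooth zero_smooth zero_vector_field
    vector_field_uminus vector_field_add
  define n where "n X Y = snd (ext.nijenhuis J (X, 0) (Y, 0))" for X Y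
  have N: "ext.nijenhuis J (X, 0) (Y, 0) = (0, n X Y)"
    if "X \<in> vector_fields A" "Y \<in> vector_fields A" for X Y
    using fst0[OF that] by (simp add: n_def prod_eq_iff)
  have n_commute: "n X Y = n Y X" if "X \<in> vector_fields A" "Y \<in> vector_fields A" for X Y
    using that by (simp add: n_def snd_nijenhuis_horizontal sym_bracket_def algebra_simps)
  have n_reeb: "n X Y = n ((\<lambda>p. \<eta> p (X p)) *\<^sub>F \<xi>) Y"
    if X: "X \<in> vector_fields A" and Y: "Y \<in> vector_fields A" for X Y
  proof -
    define h where "h = (\<lambda>p. \<eta> p (X p))"
    have h: "h *\<^sub>F \<xi> \<in> vector_fields A"
      using X closed by (simp add: h_def)
    have split: "J (X, 0) = (apply_field \<phi> X, 0) + J (h *\<^sub>F \<xi>, 0)"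
      unfolding ext_endomorphism_vertical
      by (auto simp: ext_endomorphism_def h_def fscale_def tscale_def fun_eq_iff)
    have "J (h *\<^sub>F \<xi>, 0) \<in> vector_fields A \<times> smooth_functions A"
      using X closed by (simp add: ext_endomorphism_vertical h_def)
    hence "ext.nijenhuis J (J (X, 0)) (Y, 0)
        = ext.nijenhuis J (apply_field \<phi> X, 0) (Y, 0) + ext.nijenhuis J (J (h *\<^sub>F \<xi>, 0)) (Y, 0)"
      unfolding split using X Y closed
      by (subst ext.nijenhuis_add_left[OF ext_complex_structure]) auto
    hence "- J (0, n X Y) = (0, n (apply_field \<phi> X) Y) - J (0, n (h *\<^sub>F \<xi>) Y)"
      using X Y h closed
      by (simp add: ext.nijenhuis_antilinear_left[OF ext_complex_structure] N)
    hence eq: "n X Y *\<^sub>F \<xi> = n (h *\<^sub>F \<xi>) Y *\<^sub>F \<xi>"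
      by (simp add: ext_endomorphism_def apply_field_def prod_eq_iff)
    have "\<eta> p (n X Y p *\<^sub>T \<xi> p) = \<eta> p (n (h *\<^sub>F \<xi>) Y p *\<^sub>T \<xi> p)" for p
      using fun_cong[OF eq, of p] by (simp add: fscale_def)
    thus ?thesis
      by (simp add: form_scale reeb_tangent form_reeb h_def fun_eq_iff)
  qed
  have n_vertical: "n (a *\<^sub>F \<xi>) (b *\<^sub>F \<xi>) = 0"
    if "a \<in> smooth_functions A" "b \<in> smooth_functions A" for a b
  proof -
    have 0: "apply_field \<phi> (c *\<^sub>F \<xi>) = 0" for c
      by (auto simp: apply_field_def fscale_def fun_eq_iff endo_scale reeb_tangent endo_reeb)
        (simp add: tscale_def)
    have "nabla 0 Y = 0" "nabla Y 0 = 0" if "Y \<in> vector_fields A" for Y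
      using nabla_add_left[of 0 0 Y] nabla_add_right[of Y 0 0] zero_vector_field that by auto
    moreover have "\<eta> p 0 = 0" for p
      using form_diff_reeb[OF reeb_tangent, of p 1]
      by (simp add: form_reeb tscale_def)
    ultimately show ?thesis
      using that closed by (simp add: n_def snd_nijenhuis_horizontal 0 sym_bracket_def)
        (simp add: deriv_along_def fun_eq_iff)
  qed
  have horizontal: "ext.nijenhuis J (X, 0) (Y, 0) = 0"
    if X: "X \<in> vector_fields A" and Y: "Y \<in> vector_fields A" for X Y
  proof -
    have X': "(\<lambda>p. \<eta> p (X p)) *\<^sub>F \<xi> \<in> vector_fields A"
      by (rule vector_field_scale[OF form_smooth[OF X] reeb])
    have "n X Y = n ((\<lambda>p. \<eta> p (X p)) *\<^sub>F \<xi>) Y"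
      by (rule n_reeb[OF X Y])
    also have "\<dots> = n Y ((\<lambda>p. \<eta> p (X p)) *\<^sub>F \<xi>)"
      by (rule n_commute[OF X' Y])
    also have "\<dots> = n ((\<lambda>p. \<eta> p (Y p)) *\<^sub>F \<xi>) ((\<lambda>p. \<eta> p (X p)) *\<^sub>F \<xi>)"
      by (rule n_reeb[OF Y X'])
    also have "\<dots> = 0"
      by (rule n_vertical[OF form_smooth[OF Y] form_smooth[OF X]])
    finally show ?thesis
      by (simp add: N[OF X Y] zero_prod_def)
  qed
  have J0: "J 0 = 0"
    using ext_endomorphism_vertical[of 0] by (simp add: fscale_def tscale_def zero_prod_def zero_fun_def)
  have split: "(X, a) = (X, 0) + J (a *\<^sub>F \<xi>, 0)" for X a
    by (simp add: ext_endomorphism_vertical)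
  have half: "ext.nijenhuis J (X, a) (Y, 0) = 0"
    if X: "X \<in> vector_fields A" and a: "a \<in> smooth_functions A" and Y: "Y \<in> vector_fields A"
    for X a Y
  proof -
    have a': "a *\<^sub>F \<xi> \<in> vector_fields A"
      by (rule vector_field_scale[OF a reeb])
    have mem: "(X, 0) \<in> vector_fields A \<times> smooth_functions A"
      "(Y, 0) \<in> vector_fields A \<times> smooth_functions A"
      "(a *\<^sub>F \<xi>, 0) \<in> vector_fields A \<times> smooth_functions A"
      using X Y a' zero_smooth by auto
    have "ext.nijenhuis J ((X, 0) + J (a *\<^sub>F \<xi>, 0)) (Y, 0)
        = 0 + - J (ext.nijenhuis J (a *\<^sub>F \<xi>, 0) (Y, 0))"
      by (simp only: ext.nijenhuis_add_left[OF ext_complex_structure mem(1)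
            ext.complex_structure_closed[OF ext_complex_structure mem(3)] mem(2)]
          ext.nijenhuis_antilinear_left[OF ext_complex_structure mem(3,2)] horizontal[OF X Y])
    thus ?thesis
      unfolding split[symmetric] horizontal[OF a' Y] J0 by simp
  qed
  obtain X a Y b where XY: "x = (X, a)" "y = (Y, b)" "X \<in> vector_fields A" "Y \<in> vector_fields A"
    "a \<in> smooth_functions A" and b: "b \<in> smooth_functions A"
    using x y by auto
  have b': "b *\<^sub>F \<xi> \<in> vector_fields A"
    by (rule vector_field_scale[OF b reeb])
  have mem: "(Y, 0) \<in> vector_fields A \<times> smooth_functions A"
    "(b *\<^sub>F \<xi>, 0) \<in> vector_fields A \<times> smooth_functions A"
    using XY(4) b' zero_smooth by auto
  have "ext.nijenhuis J x ((Y, 0) + J (b *\<^sub>F \<xi>, 0)) = 0 + - J (ext.nijenhuis J x (b *\<^sub>F \<xi>, 0))"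
    by (simp only: ext.nijenhuis_add_right[OF ext_complex_structure x mem(1)
          ext.complex_structure_closed[OF ext_complex_structure mem(2)]]
        ext.nijenhuis_antilinear_right[OF ext_complex_structure x mem(2)]
        half[OF XY(3,5,4), folded XY(1)])
  thus ?thesis
    unfolding split[symmetric] XY(1,2) half[OF XY(3,5) b'] J0 by simp
qed

end

section \<open>The associated Nijenhuis tensor of a metric structure\<close>

locale almost_contact_metric = almost_contact A nabla \<phi> \<xi> \<eta>
  for A :: "('a::{t2_space, second_countable_topology}, 'e::euclidean_space) atlas"
    and nabla \<phi> \<xi> \<eta> +
  fixes g :: "'a \<Rightarrow> 'a tangent \<Rightarrow> 'a tangent \<Rightarrow> real" and \<epsilon> :: real
  assumes metric: "pseudo_riemannian_metric A g"
    and levi_civita: "levi_civita_connection A g nabla"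
    and sign_square: "\<epsilon> * \<epsilon> = 1"
    and metric_endo: "u \<in> tangent_space A p \<Longrightarrow> v \<in> tangent_space A p
      \<Longrightarrow> g p (\<phi> p u) (\<phi> p v) = \<epsilon> * g p u v + \<eta> p u * \<eta> p v"
begin

lemma metric_add_left: "u \<in> tangent_space A p \<Longrightarrow> v \<in> tangent_space A p \<Longrightarrow> w \<in> tangent_space A p
    \<Longrightarrow> g p (u + v) w = g p u w + g p v w"
  and metric_scale_left: "u \<in> tangent_space A p \<Longrightarrow> w \<in> tangent_space A p
    \<Longrightarrow> g p (r *\<^sub>T u) w = r * g p u w"
  and metric_commute: "u \<in> tangent_space A p \<Longrightarrow> v \<in> tangent_space A p \<Longrightarrow> g p u v = g p v u"
  using metric by (auto simp: pseudo_riemannian_metric_def)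

lemma metric_diff_left:
  assumes "u \<in> tangent_space A p" "v \<in> tangent_space A p" "w \<in> tangent_space A p"
  shows "g p (u - v) w = g p u w - g p v w"
  unfolding tangent_diff using assms
  by (simp add: metric_add_left metric_scale_left tangent_space_scale)

lemma sign_cancel: "\<epsilon> * (\<epsilon> * r) = r"
  by (metis mult.assoc mult_1 sign_square)

text \<open>
  Evaluate the compatibility of \<open>g\<close> and \<open>\<phi>\<close> at \<open>\<xi>\<close> and \<open>u\<close>, where \<open>g (\<phi> \<xi>, \<phi> u) = 0\<close> by \<open>\<phi> \<xi> = 0\<close>.
\<close>

lemma metric_reeb:
  assumes u: "u \<in> tangent_space A p"
  shows "g p (\<xi> p) u = - \<epsilon> * \<eta> p u"
proof -
  have "g p 0 (\<phi> p u) = 0"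
    using metric_scale_left[OF endo_tangent[OF u] endo_tangent[OF u], of 0]
    by (simp add: tscale_def zero_fun_def)
  hence "\<epsilon> * g p (\<xi> p) u + \<eta> p u = 0"
    using metric_endo[OF reeb_tangent u] by (simp add: endo_reeb form_reeb)
  hence "\<epsilon> * (\<epsilon> * g p (\<xi> p) u) = \<epsilon> * - \<eta> p u"
    by (simp only: eq_neg_iff_add_eq_0[symmetric])
  thus ?thesis
    by (simp add: sign_cancel)
qed

lemma metric_compatible:
  assumes "X \<in> vector_fields A" "Y \<in> vector_fields A" "Z \<in> vector_fields A"
  shows "X p (\<lambda>q. g q (Y q) (Z q)) = g p (nabla X Y p) (Z p) + g p (Y p) (nabla X Z p)"
  using levi_civita assms unfolding levi_civita_connection_def by blast

lemma lie_bracket_eq: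
  assumes "X \<in> vector_fields A" "Y \<in> vector_fields A"
  shows "lie_bracket X Y p = nabla X Y p - nabla Y X p"
proof -
  have "nabla X Y - nabla Y X = lie_bracket X Y"
    using levi_civita assms unfolding levi_civita_connection_def by blast
  thus ?thesis
    by (simp flip: minus_apply)
qed

text \<open>Differentiate \<open>g (\<xi>, Y) = - \<epsilon> \<eta> Y\<close> along \<open>X\<close>.\<close>

lemma nabla_reeb:
  assumes X: "X \<in> vector_fields A" and Y: "Y \<in> vector_fields A"
  shows "g p (nabla X \<xi> p) (Y p) = - \<epsilon> * (X p (\<lambda>q. \<eta> q (Y q)) - \<eta> p (nabla X Y p))"
proof -
  have "X p (\<lambda>q. g q (\<xi> q) (Y q)) = X p (\<lambda>q. - \<epsilon> * \<eta> q (Y q))"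
    using metric_reeb[OF vector_field_tangent[OF Y]] by simp
  also have "\<dots> = - \<epsilon> * X p (\<lambda>q. \<eta> q (Y q))"
    by (rule tangent_scale[OF vector_field_tangent[OF X] form_smooth[OF Y]])
  finally show ?thesis
    using metric_compatible[OF X reeb Y]
      metric_reeb[OF vector_field_tangent[OF nabla_closed[OF X Y]]]
    by (simp add: algebra_simps)
qed

text \<open>
  For a metric connection without torsion, \<open>(\<L>\<^sub>\<xi> g) (X, Y) = g (\<nabla>\<^sub>X \<xi>, Y) + g (X, \<nabla>\<^sub>Y \<xi>)\<close>.
\<close>

lemma lie_derivative_reeb:
  assumes X: "X \<in> vector_fields A" and Y: "Y \<in> vector_fields A"
  shows "lie_derivative \<xi> g X Y p = - \<epsilon> * (X p (\<lambda>q. \<eta> q (Y q)) + Y p (\<lambda>q. \<eta> q (X q))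
      - \<eta> p (sym_bracket nabla X Y p))"
proof -
  note t = vector_field_tangent nabla_closed X Y reeb
  have 1: "g p (lie_bracket \<xi> X p) (Y p) = g p (nabla \<xi> X p) (Y p) - g p (nabla X \<xi> p) (Y p)"
    using t by (simp add: lie_bracket_eq metric_diff_left)
  have "g p (X p) (lie_bracket \<xi> Y p) = g p (lie_bracket \<xi> Y p) (X p)"
    using t by (intro metric_commute) (auto simp: lie_bracket_eq tangent_space_diff)
  also have "\<dots> = g p (nabla \<xi> Y p) (X p) - g p (nabla Y \<xi> p) (X p)"
    using t by (simp add: lie_bracket_eq metric_diff_left)
  also have "g p (nabla \<xi> Y p) (X p) = g p (X p) (nabla \<xi> Y p)"
    using t by (simp add: metric_commute)
  finally show ?thesis
    using t 1 by (simp add: lie_derivative_def metric_compatible nabla_reeb sym_bracket_def form_add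
        algebra_simps)
qed

text \<open>
  The summand \<open>\<eta> {X, Y} \<xi>\<close> that \<open>\<phi>\<^sup>2 = - 1 + \<xi> \<otimes> \<eta>\<close> contributes cancels against the same summand of
  the Lie derivative. What is left of the Lie derivative are the derivatives of \<open>\<eta> X\<close> and \<open>\<eta> Y\<close>,
  which in the operator of \<open>J\<close> come from the second component of the bracket.
\<close>

lemma assoc_nijenhuis_horizontal:
  assumes X: "X \<in> vector_fields A" and Y: "Y \<in> vector_fields A"
  shows "endo_sym_bracket nabla \<phi> X Y - (\<lambda>p. \<epsilon> * lie_derivative \<xi> g X Y p) *\<^sub>F \<xi>
    = fst (ext.nijenhuis J (X, 0) (Y, 0))"
proof -
  have square: "apply_field \<phi> (apply_field \<phi> (sym_bracket nabla X Y))
      = (\<lambda>p. \<eta> p (sym_bracket nabla X Y p)) *\<^sub>F \<xi> - sym_bracket nabla X Y"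
    using vector_field_tangent[OF sym_bracket_closed[OF X Y]]
    by (auto simp: apply_field_def fscale_def fun_eq_iff endo_square)
  show ?thesis
    unfolding fst_nijenhuis_horizontal[OF X Y] endo_sym_bracket_def square lie_derivative_reeb[OF X Y]
    by (simp add: sign_cancel fscale_def tscale_def deriv_along_def fun_eq_iff algebra_simps)
qed

end

section \<open>Three almost contact structures\<close>

lemma tscale_0: "0 *\<^sub>T v = 0" and tscale_minus_1: "(- 1) *\<^sub>T v = - v"
  by (auto simp: tscale_def fun_eq_iff)

lemma index_permutations:
  assumes "{\<alpha>, \<beta>, \<gamma>} = {1, 2, 3 :: nat}"
  shows "(\<alpha>, \<beta>, \<gamma>) \<in> {(1, 2, 3), (2, 3, 1), (3, 1, 2), (1, 3, 2), (3, 2, 1), (2, 1, 3)}"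
proof -
  have "\<alpha> = 1 \<or> \<alpha> = 2 \<or> \<alpha> = 3" "\<beta> = 1 \<or> \<beta> = 2 \<or> \<beta> = 3" "\<gamma> = 1 \<or> \<gamma> = 2 \<or> \<gamma> = 3"
    using assms by blast+
  moreover have "1 \<in> {\<alpha>, \<beta>, \<gamma>}" "2 \<in> {\<alpha>, \<beta>, \<gamma>}" "3 \<in> {\<alpha>, \<beta>, \<gamma>}"
    unfolding assms by blast+
  ultimately show ?thesis
    by (elim disjE) simp_all
qed

lemma levi_civita_symbol_swap: "levi_civita_symbol \<beta> \<alpha> \<gamma> = - levi_civita_symbol \<alpha> \<beta> \<gamma>"
  by (auto simp: levi_civita_symbol_def)

locale almost_contact_3_metric = manifold_connection A nabla
  for A :: "('a::{t2_space, second_countable_topology}, 'e::euclidean_space) atlas" and nabla +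
  fixes \<phi> :: "nat \<Rightarrow> 'a \<Rightarrow> 'a tangent \<Rightarrow> 'a tangent" and \<xi> :: "nat \<Rightarrow> 'a vfield"
    and \<eta> :: "nat \<Rightarrow> 'a \<Rightarrow> 'a tangent \<Rightarrow> real"
    and g :: "'a \<Rightarrow> 'a tangent \<Rightarrow> 'a tangent \<Rightarrow> real"
  assumes contact_3: "almost_contact_3_structure A \<phi> \<xi> \<eta>"
    and metric: "hermitian_norden_metric A \<phi> \<eta> g"
    and levi_civita: "levi_civita_connection A g nabla"
begin

lemma component:
  assumes \<alpha>: "\<alpha> \<in> {1, 2, 3}"
  shows "almost_contact_metric A nabla (\<phi> \<alpha>) (\<xi> \<alpha>) (\<eta> \<alpha>) g (hn_sign \<alpha>)"
proof
  have sum0: "(\<Sum>\<gamma>\<in>{1, 2, 3}. levi_civita_symbol \<alpha> \<alpha> \<gamma> *\<^sub>T v \<gamma>) = 0" for v :: "nat \<Rightarrow> 'a tangent"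
    using \<alpha> by (auto simp: levi_civita_symbol_def tscale_0)
  have sum0': "(\<Sum>\<gamma>\<in>{1, 2, 3}. levi_civita_symbol \<alpha> \<alpha> \<gamma> * v \<gamma>) = 0" for v :: "nat \<Rightarrow> real"
    using \<alpha> by (auto simp: levi_civita_symbol_def)
  have S: "\<phi> \<alpha> p (\<phi> \<alpha> p u) = (- kronecker \<alpha> \<alpha>) *\<^sub>T u + \<eta> \<alpha> p u *\<^sub>T \<xi> \<alpha> p
             + (\<Sum>\<gamma>\<in>{1, 2, 3}. levi_civita_symbol \<alpha> \<alpha> \<gamma> *\<^sub>T \<phi> \<gamma> p u)"
     "\<phi> \<alpha> p (\<xi> \<alpha> p) = (\<Sum>\<gamma>\<in>{1, 2, 3}. levi_civita_symbol \<alpha> \<alpha> \<gamma> *\<^sub>T \<xi> \<gamma> p)"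
     "\<eta> \<alpha> p (\<phi> \<alpha> p u) = (\<Sum>\<gamma>\<in>{1, 2, 3}. levi_civita_symbol \<alpha> \<alpha> \<gamma> * \<eta> \<gamma> p u)"
     "\<eta> \<alpha> p (\<xi> \<alpha> p) = kronecker \<alpha> \<alpha>"
    if "u \<in> tangent_space A p" for p u
    using contact_3 \<alpha> that unfolding almost_contact_3_structure_def by blast+
  show "endomorphism_field A (\<phi> \<alpha>)" "\<xi> \<alpha> \<in> vector_fields A" "one_form A (\<eta> \<alpha>)"
    using contact_3 \<alpha> unfolding almost_contact_3_structure_def by blast+
  hence t: "\<xi> \<alpha> p \<in> tangent_space A p" for p
    by (simp add: vector_fields_def)
  show "\<phi> \<alpha> p (\<phi> \<alpha> p u) = \<eta> \<alpha> p u *\<^sub>T \<xi> \<alpha> p - u" "\<eta> \<alpha> p (\<phi> \<alpha> p u) = 0"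
    if "u \<in> tangent_space A p" for u p
    using S[OF that] unfolding sum0 sum0' by (simp_all add: kronecker_def tscale_minus_1)
  show "\<phi> \<alpha> p (\<xi> \<alpha> p) = 0" "\<eta> \<alpha> p (\<xi> \<alpha> p) = 1" for p
    using S[OF t] unfolding sum0 by (simp_all add: kronecker_def)
  show "pseudo_riemannian_metric A g"
    using metric by (simp add: hermitian_norden_metric_def)
  show "g p (\<phi> \<alpha> p u) (\<phi> \<alpha> p v) = hn_sign \<alpha> * g p u v + \<eta> \<alpha> p u * \<eta> \<alpha> p v"
    if "u \<in> tangent_space A p" "v \<in> tangent_space A p" for u v p
    using metric \<alpha> that unfolding hermitian_norden_metric_def by blast
qed (simp_all add: levi_civita hn_sign_def)

abbreviation J :: "nat \<Rightarrow> 'a vfield \<times> ('a \<Rightarrow> real) \<Rightarrow> 'a vfield \<times> ('a \<Rightarrow> real)" where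
  "J \<alpha> \<equiv> ext_endomorphism (\<phi> \<alpha>) (\<xi> \<alpha>) (\<eta> \<alpha>)"

lemma contact: "\<alpha> \<in> {1, 2, 3} \<Longrightarrow> almost_contact A nabla (\<phi> \<alpha>) (\<xi> \<alpha>) (\<eta> \<alpha>)"
  using component by (rule almost_contact_metric.axioms(1))

text \<open>
  The quaternion relations \<open>J\<^sub>\<alpha> J\<^sub>\<beta> = r J\<^sub>\<gamma>\<close>, where \<open>r\<close> is the sign of the permutation. The correction
  term \<open>\<eta>\<^sub>\<beta>(X) \<xi>\<^sub>\<alpha>\<close> of \<open>\<phi>\<^sub>\<alpha> \<phi>\<^sub>\<beta>\<close> is exactly the one that \<open>J\<^sub>\<alpha>\<close> subtracts for the function component
  \<open>\<eta>\<^sub>\<beta>(X)\<close> of \<open>J\<^sub>\<beta> (X, a)\<close>.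
\<close>

lemma ext_endomorphism_compose:
  assumes perm: "{\<alpha>, \<beta>, \<gamma>} = {1, 2, 3}" and X: "X \<in> vector_fields A"
  defines "r \<equiv> levi_civita_symbol \<alpha> \<beta> \<gamma>"
  shows "J \<alpha> (J \<beta> (X, a)) = ((\<lambda>p. r) *\<^sub>F fst (J \<gamma> (X, a)), \<lambda>p. r * snd (J \<gamma> (X, a)) p)"
proof -
  have \<alpha>\<beta>: "\<alpha> \<in> {1, 2, 3}" "\<beta> \<in> {1, 2, 3}" and kron: "kronecker \<alpha> \<beta> = 0"
    using index_permutations[OF perm] by (auto simp: kronecker_def)
  interpret a: almost_contact A nabla "\<phi> \<alpha>" "\<xi> \<alpha>" "\<eta> \<alpha>"
    by (rule contact[OF \<alpha>\<beta>(1)])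
  interpret b: almost_contact A nabla "\<phi> \<beta>" "\<xi> \<beta>" "\<eta> \<beta>"
    by (rule contact[OF \<alpha>\<beta>(2)])
  note tan = vector_field_tangent[OF X]
  have sum: "(\<Sum>\<delta>\<in>{1, 2, 3}. levi_civita_symbol \<alpha> \<beta> \<delta> *\<^sub>T v \<delta>) = r *\<^sub>T v \<gamma>"
    for v :: "nat \<Rightarrow> 'a tangent"
    using index_permutations[OF perm] by (auto simp: r_def levi_civita_symbol_def tscale_0)
  have sum': "(\<Sum>\<delta>\<in>{1, 2, 3}. levi_civita_symbol \<alpha> \<beta> \<delta> * v \<delta>) = r * v \<gamma>" for v :: "nat \<Rightarrow> real"
    using index_permutations[OF perm] by (auto simp: r_def levi_civita_symbol_def)
  have S: "\<phi> \<alpha> p (\<phi> \<beta> p u) = (- kronecker \<alpha> \<beta>) *\<^sub>T u + \<eta> \<beta> p u *\<^sub>T \<xi> \<alpha> p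
             + (\<Sum>\<delta>\<in>{1, 2, 3}. levi_civita_symbol \<alpha> \<beta> \<delta> *\<^sub>T \<phi> \<delta> p u)"
     "\<phi> \<alpha> p (\<xi> \<beta> p) = (\<Sum>\<delta>\<in>{1, 2, 3}. levi_civita_symbol \<alpha> \<beta> \<delta> *\<^sub>T \<xi> \<delta> p)"
     "\<eta> \<alpha> p (\<phi> \<beta> p u) = (\<Sum>\<delta>\<in>{1, 2, 3}. levi_civita_symbol \<alpha> \<beta> \<delta> * \<eta> \<delta> p u)"
     "\<eta> \<alpha> p (\<xi> \<beta> p) = kronecker \<alpha> \<beta>"
    if "u \<in> tangent_space A p" for p u
    using contact_3 \<alpha>\<beta> that unfolding almost_contact_3_structure_def by blast+
  note mem = b.endo_tangent[OF tan] b.reeb_tangent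
  have fst: "\<phi> \<alpha> p (\<phi> \<beta> p (X p) - a p *\<^sub>T \<xi> \<beta> p)
      = \<eta> \<beta> p (X p) *\<^sub>T \<xi> \<alpha> p + r *\<^sub>T \<phi> \<gamma> p (X p) + (- a p) *\<^sub>T r *\<^sub>T \<xi> \<gamma> p" for p
    unfolding a.tangent_diff_scale a.endo_add[OF mem(1) tangent_space_scale[OF mem(2)]]
      a.endo_scale[OF mem(2)] S(1)[OF tan] S(2)[OF tan] sum kron
    by (simp add: tscale_0)
  have snd: "\<eta> \<alpha> p (\<phi> \<beta> p (X p) - a p *\<^sub>T \<xi> \<beta> p) = r * \<eta> \<gamma> p (X p)" for p
    unfolding a.tangent_diff_scale a.form_add[OF mem(1) tangent_space_scale[OF mem(2)]]
      a.form_scale[OF mem(2)] S(3)[OF tan] S(4)[OF tan] sum' kron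
    by simp
  show ?thesis
    by (simp add: ext_endomorphism_def apply_field_def fscale_def fst snd)
      (simp add: fun_eq_iff tscale_def algebra_simps)
qed

lemma assoc_nijenhuis_vanishes_iff:
  assumes "\<alpha> \<in> {1, 2, 3}"
  shows "assoc_nijenhuis_vanishes A g nabla \<phi> \<xi> \<alpha> \<longleftrightarrow>
    (\<forall>x\<in>vector_fields A \<times> smooth_functions A. \<forall>y\<in>vector_fields A \<times> smooth_functions A.
       ext.nijenhuis (J \<alpha>) x y = 0)"
proof -
  interpret a: almost_contact_metric A nabla "\<phi> \<alpha>" "\<xi> \<alpha>" "\<eta> \<alpha>" g "hn_sign \<alpha>"
    by (rule component[OF assms])
  have "assoc_nijenhuis_vanishes A g nabla \<phi> \<xi> \<alpha> \<longleftrightarrow>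
      (\<forall>X\<in>vector_fields A. \<forall>Y\<in>vector_fields A. fst (ext.nijenhuis (J \<alpha>) (X, 0) (Y, 0)) = 0)"
    by (simp add: assoc_nijenhuis_vanishes_def assoc_nijenhuis_def a.assoc_nijenhuis_horizontal)
  also have "\<dots> \<longleftrightarrow>
      (\<forall>x\<in>vector_fields A \<times> smooth_functions A. \<forall>y\<in>vector_fields A \<times> smooth_functions A.
         ext.nijenhuis (J \<alpha>) x y = 0)"
  proof (intro iffI ballI)
    fix X Y
    assume "\<forall>x\<in>vector_fields A \<times> smooth_functions A. \<forall>y\<in>vector_fields A \<times> smooth_functions A.
        ext.nijenhuis (J \<alpha>) x y = 0"
      and "X \<in> vector_fields A" "Y \<in> vector_fields A"
    hence "ext.nijenhuis (J \<alpha>) (X, 0) (Y, 0) = 0"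
      using a.zero_smooth by blast
    thus "fst (ext.nijenhuis (J \<alpha>) (X, 0) (Y, 0)) = 0"
      by simp
  qed (rule a.nijenhuis_vanishes, blast+)
  finally show ?thesis .
qed

lemma nijenhuis_third_vanishes:
  assumes perm: "{\<alpha>, \<beta>, \<gamma>} = {1, 2, 3}" and sign: "levi_civita_symbol \<alpha> \<beta> \<gamma> = 1"
    and N\<alpha>: "assoc_nijenhuis_vanishes A g nabla \<phi> \<xi> \<alpha>"
    and N\<beta>: "assoc_nijenhuis_vanishes A g nabla \<phi> \<xi> \<beta>"
  shows "assoc_nijenhuis_vanishes A g nabla \<phi> \<xi> \<gamma>"
proof -
  let ?V = "vector_fields A \<times> smooth_functions A"
  have \<alpha>: "\<alpha> \<in> {1, 2, 3}" and \<beta>: "\<beta> \<in> {1, 2, 3}" and \<gamma>: "\<gamma> \<in> {1, 2, 3}"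
    using perm by blast+
  have perm': "{\<beta>, \<alpha>, \<gamma>} = {1, 2, 3}"
    using perm by (simp add: insert_commute)
  note J = almost_contact.ext_complex_structure[OF contact]
  have J1: "J \<alpha> (J \<beta> z) = J \<gamma> z" and J2: "J \<beta> (J \<alpha> z) = - J \<gamma> z" if mem: "z \<in> ?V" for z
  proof -
    obtain X a where z: "z = (X, a)" "X \<in> vector_fields A"
      using mem by (cases z) simp
    show "J \<alpha> (J \<beta> z) = J \<gamma> z"
      unfolding z(1) ext_endomorphism_compose[OF perm z(2)] sign
      by (simp add: fscale_def tscale_def)
    show "J \<beta> (J \<alpha> z) = - J \<gamma> z"
      unfolding z(1) ext_endomorphism_compose[OF perm' z(2)] levi_civita_symbol_swap[of \<beta> \<alpha>] sign
      by (simp add: fscale_def tscale_def prod_eq_iff fun_eq_iff)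
  qed
  have two_torsion_free: "z = 0" if "z + z = 0" for z :: "'a vfield \<times> ('a \<Rightarrow> real)"
  proof -
    have "fst z p f + fst z p f = 0" "snd z p + snd z p = 0" for p f
      using arg_cong[OF that, of "\<lambda>z. fst z p f"] arg_cong[OF that, of "\<lambda>z. snd z p"] by simp_all
    thus ?thesis
      by (simp add: prod_eq_iff fun_eq_iff)
  qed
  have "ext.nijenhuis (J \<gamma>) x y = 0" if x: "x \<in> ?V" and y: "y \<in> ?V" for x y
  proof -
    have "ext.nijenhuis (J \<gamma>) x y = ext.nijenhuis (\<lambda>z. J \<alpha> (J \<beta> z)) x y"
      unfolding ext.nijenhuis_def
      by (simp only: J1 ext.bracket_closed ext.complex_structure_closed[OF J[OF \<gamma>]] x y)
    also have "\<dots> = 0"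
    proof (rule ext.nijenhuis_compose_vanishes[OF J[OF \<alpha>] J[OF \<beta>] _ _ _ two_torsion_free x y])
      show "J \<beta> (J \<alpha> z) = - J \<alpha> (J \<beta> z)" if "z \<in> ?V" for z
        by (simp only: J1[OF that] J2[OF that])
      show "ext.nijenhuis (J \<alpha>) u v = 0" if "u \<in> ?V" "v \<in> ?V" for u v
        using N\<alpha> that unfolding assoc_nijenhuis_vanishes_iff[OF \<alpha>] by blast
      show "ext.nijenhuis (J \<beta>) u v = 0" if "u \<in> ?V" "v \<in> ?V" for u v
        using N\<beta> that unfolding assoc_nijenhuis_vanishes_iff[OF \<beta>] by blast
    qed
    finally show ?thesis .
  qed
  thus ?thesis
    unfolding assoc_nijenhuis_vanishes_iff[OF \<gamma>] by blast
qed

end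

theorem theorem15p6:
  fixes A :: "('a::{t2_space, second_countable_topology}, 'e::euclidean_space) atlas"
    and n :: nat
    and \<phi> :: "nat \<Rightarrow> 'a \<Rightarrow> 'a tangent \<Rightarrow> 'a tangent"
    and \<xi> :: "nat \<Rightarrow> 'a vfield"
    and \<eta> :: "nat \<Rightarrow> 'a \<Rightarrow> 'a tangent \<Rightarrow> real"
    and g :: "'a \<Rightarrow> 'a tangent \<Rightarrow> 'a tangent \<Rightarrow> real"
    and nabla :: "'a vfield \<Rightarrow> 'a vfield \<Rightarrow> 'a vfield"
    and \<alpha> \<beta> \<gamma> :: nat
  assumes "smooth_manifold A"
    and "DIM('e) = 4 * n + 3"
    and "almost_contact_3_structure A \<phi> \<xi> \<eta>"
    and "hermitian_norden_metric A \<phi> \<eta> g"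
    and "levi_civita_connection A g nabla"
    and "{\<alpha>, \<beta>, \<gamma>} = {1, 2, 3}"
    and "assoc_nijenhuis_vanishes A g nabla \<phi> \<xi> \<alpha>"
    and "assoc_nijenhuis_vanishes A g nabla \<phi> \<xi> \<beta>"
  shows "assoc_nijenhuis_vanishes A g nabla \<phi> \<xi> \<gamma>"
proof -
  interpret almost_contact_3_metric A nabla \<phi> \<xi> \<eta> g
    using assms(1,3-5) by unfold_locales (simp_all add: levi_civita_connection_def)
  have swap: "{\<beta>, \<alpha>, \<gamma>} = {1, 2, 3}"
    using assms(6) by (simp add: insert_commute)
  \<comment> \<open>The hypotheses are symmetric in the first two indices, so the permutation can be taken even.\<close>
  have "levi_civita_symbol \<alpha> \<beta> \<gamma> = 1 \<or> levi_civita_symbol \<beta> \<alpha> \<gamma> = 1"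
    using index_permutations[OF assms(6)] by (auto simp: levi_civita_symbol_def)
  thus ?thesis
    using nijenhuis_third_vanishes[OF assms(6) _ assms(7,8)]
      nijenhuis_third_vanishes[OF swap _ assms(8,7)] by blast
qed

end
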